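(* Let $f\in C^3(\mathbb{R}^d)$, $d\ge 2$, let $k\in\{0,\dots,d\}$, and let $\mathbf{x}^*$ be a strict index-$k$ critical point of $f$. Suppose there are $r_0>0$, $M>0$, $L\ge\mu>0$ such that, with $U=\{\mathbf{x}\in\mathbb{R}^d:\|\mathbf{x}-\mathbf{x}^*\|_2\le r_0\}$, one has $\|\nabla^2 f(\mathbf{x})-\nabla^2 f(\mathbf{y})\|_2\le M\|\mathbf{x}-\mathbf{y}\|_2$ for all $\mathbf{x},\mathbf{y}\in U$, and for every $\mathbf{x}\in U$ the eigenvalues $\lambda_1\le\cdots\le\lambda_d$ of $\nabla^2 f(\mathbf{x})$ satisfy $$-L\le\lambda_1\le\cdots\le\lambda_k\le-\mu<0<\mu\le\lambda_{k+1}\le\cdots\le\lambda_d\le L$$ (the inequalities on the negative, respectively positive, eigenvalues being omitted when $k=0$, respectively $k=d$). Let $0<\sigma_{\min}\le\sigma_j\le\sigma_{\max}$ for all $j\in\mathbb{N}$, and let $(\mathbf{x}_j)_{j\in\mathbb{N}}$ be generated by the inexact index-$k$ cubic regularization iteration described in the context, with subspace errors $\delta_j$, residuals $\boldsymbol{\xi}_j$ and forcing parameters $\eta_j\ge 0$. Fix $\bar\eta\ge0$ and $0\le\bar\delta\le\frac{\mu}{4L}$ and suppose $\delta_j\le\bar\delta$ and $\eta_j\le\bar\eta$ for all $j\in\mathbb{N}$. Define $$K=\frac{2(1+\bar\eta)}{\mu},\quad \rho=\min\left\{r_0,\frac{\mu}{M}\right\},\quad r=\frac{\rho}{1+KL},$$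 $$C_1=\frac{2L}{\mu}\max\{1,2LK\},\quad C_2=\frac2\mu\left(\sigma_{\max}+\frac M2\right)K^2L^2.$$ Assume $\delta_j+\eta_j\le\varepsilon$ for all $j\in\mathbb{N}$, where $C_1\varepsilon<1$, and define $$r_{\rm lin}=\min\left\{r,\frac{1-C_1\varepsilon}{2C_2}\right\},\qquad q=C_1\varepsilon+C_2r_{\rm lin}.$$ If $\|\mathbf{x}_0-\mathbf{x}^*\|_2\le r_{\rm lin}$, then: (i) $\|\mathbf{x}_{j+1}-\mathbf{x}^*\|_2\le q\|\mathbf{x}_j-\mathbf{x}^*\|_2$ for all $j\in\mathbb{N}$, with $q\le(1+C_1\varepsilon)/2<1$, and hence $\mathbf{x}_j$ converges linearly to $\mathbf{x}^*$. (ii) If moreover $\delta_j+\eta_j\to0$, then $\mathbf{x}_j$ converges superlinearly to $\mathbf{x}^*$. (iii) If, in addition, there is $c>0$ with $\delta_j+\eta_j\le c\|\mathbf{x}_j-\mathbf{x}^*\|_2$ for all sufficiently large $j$, then $\mathbf{x}_j$ converges quadratically to $\mathbf{x}^*$. (iv) In particular, quadratic convergence holds if, for large $j$, $\delta_j=O(\|\nabla f(\mathbf{x}_j)\|_2)$ and $\|\boldsymbol{\xi}_j\|_2=O(\|\nabla f(\mathbf{x}_j)\|_2^2)$ (or $\eta_j=O(\|\nabla f(\mathbf{x}_j)\|_2)$ in place of the latter).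
   Context: Standing assumption of the paper: $f\in C^3(\mathbb{R}^d)$ with $d\ge2$, having finitely many non-degenerate critical points. $\|\cdot\|_2$ is the Euclidean norm on vectors and the spectral norm on matrices; $\mathbf{I}$ is the identity matrix. A strict index-$k$ critical point is a point $\mathbf{x}^*$ with $\nabla f(\mathbf{x}^* )=\mathbf{0}$ such that $\nabla^2 f(\mathbf{x}^* )$ is nonsingular with exactly $k$ negative eigenvalues (with multiplicity). Inexact index-$k$ cubic regularization iteration: at each $j$, let $H_j=\nabla^2 f(\mathbf{x}_j)$ and $P_j=\sum_{i=1}^k\mathbf{v}_i\mathbf{v}_i^\top$, where $\mathbf{v}_1,\dots,\mathbf{v}_k$ are orthonormal eigenvectors of $H_j$ associated with its $k$ smallest eigenvalues. Let $\widetilde V_j\in\mathbb{R}^{d\times k}$ have orthonormal columns (computed approximate eigenvectors), and set $$\widetilde P_j=\widetilde V_j\widetilde V_j^\top,\quad \widetilde R_j=\mathbf{I}-2\widetilde P_j,\quad \delta_j=\|\widetilde P_j-P_j\|_2,\quad \widetilde B_j=\tfrac12\left(\widetilde R_jH_j+H_j\widetilde R_j\right).$$ The computed step $\mathbf{s}_j\in\mathbb{R}^d$ satisfies $$\boldsymbol{\xi}_j=\widetilde R_j\nabla f(\mathbf{x}_j)+\widetilde B_j\mathbf{s}_j+\sigma_j\|\mathbf{s}_j\|_2\mathbf{s}_j,\qquad \|\boldsymbol{\xi}_j\|_2\le\eta_j\|\nabla f(\mathbf{x}_j)\|_2,$$ and $\mathbf{x}_{j+1}=\mathbf{x}_j+\mathbf{s}_j$.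 Conventions: superlinear convergence means $\mathbf{x}_j\to\mathbf{x}^*$ and $\|\mathbf{x}_{j+1}-\mathbf{x}^*\|_2\le\theta_j\|\mathbf{x}_j-\mathbf{x}^*\|_2$ for some $\theta_j\to0$; quadratic convergence means $\mathbf{x}_j\to\mathbf{x}^*$ and there is a constant $C'$ with $\|\mathbf{x}_{j+1}-\mathbf{x}^*\|_2\le C'\|\mathbf{x}_j-\mathbf{x}^*\|_2^2$ for all sufficiently large $j$. $a_j=O(b_j)$ means there is a constant $c'$ with $a_j\le c'b_j$ for all sufficiently large $j$. *)

theory Defs
  imports "HOL-Analysis.Analysis" "HOL-Computational_Algebra.Polynomial"
    "HOL-Library.Landau_Symbols"
begin

definition partial_deriv :: "'n \<Rightarrow> (real^'n \<Rightarrow> real) \<Rightarrow> real^'n \<Rightarrow> real" where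
  "partial_deriv i f x = frechet_derivative f (at x) (axis i 1)"

(* f is of class C^m on the whole space *)
primrec C_class :: "nat \<Rightarrow> (real^'n \<Rightarrow> real) \<Rightarrow> bool" where
  "C_class 0 f \<longleftrightarrow> continuous_on UNIV f"
| "C_class (Suc m) f \<longleftrightarrow> f differentiable_on UNIV \<and> (\<forall>i. C_class m (partial_deriv i f))"

definition gradient :: "(real^'n \<Rightarrow> real) \<Rightarrow> real^'n \<Rightarrow> real^'n" where
  "gradient f x = (\<chi> i. partial_deriv i f x)"

definition hessian :: "(real^'n \<Rightarrow> real) \<Rightarrow> real^'n \<Rightarrow> real^'n^'n" where
  "hessian f x = jacobian (gradient f) (at x)"

definition spectral_norm :: "real^'n^'n \<Rightarrow> real" where
  "spectral_norm A = onorm ((*v) A)"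

definition charpoly :: "real^'n^'n \<Rightarrow> real poly" where
  "charpoly A = det (\<chi> i j. if i = j then [:- (A $ i $ j), 1:] else [:- (A $ i $ j):])"

(* The real eigenvalues in nondecreasing order, repeated according to algebraic multiplicity.
   It is applied to Hessians only; those are symmetric, so the list has length CARD('n).
   List positions start at 0: the i-th smallest eigenvalue is  eigvals A ! (i - 1). *)
definition eigvals :: "real^'n^'n \<Rightarrow> real list" where
  "eigvals A = sorted_list_of_multiset (proots (charpoly A))"

definition strict_index_critical_point :: "(real^'n \<Rightarrow> real) \<Rightarrow> nat \<Rightarrow> real^'n \<Rightarrow> bool" where
  "strict_index_critical_point f k x \<longleftrightarrow>
     gradient f x = 0 \<and> invertible (hessian f x) \<and>
     length (filter (\<lambda>l. l < 0) (eigvals (hessian f x))) = k"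

(* A d x k matrix, where k may be 0, is given by its columns w 0, ..., w (k - 1). *)
definition orthonormal_family :: "nat \<Rightarrow> (nat \<Rightarrow> real^'n) \<Rightarrow> bool" where
  "orthonormal_family k w \<longleftrightarrow> (\<forall>i<k. \<forall>l<k. w i \<bullet> w l = (if i = l then 1 else 0))"

definition lowest_eigenvectors :: "nat \<Rightarrow> real^'n^'n \<Rightarrow> (nat \<Rightarrow> real^'n) \<Rightarrow> bool" where
  "lowest_eigenvectors k A v \<longleftrightarrow>
     orthonormal_family k v \<and> (\<forall>i<k. A *v v i = (eigvals A ! i) *\<^sub>R v i)"

(* The matrix W W^T, i.e. the sum of the matrices w_i w_i^T over i < k *)
definition proj_mat :: "nat \<Rightarrow> (nat \<Rightarrow> real^'n) \<Rightarrow> real^'n^'n" where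
  "proj_mat k w = (\<chi> a b. \<Sum>i<k. w i $ a * w i $ b)"

definition refl_mat :: "nat \<Rightarrow> (nat \<Rightarrow> real^'n) \<Rightarrow> real^'n^'n" where
  "refl_mat k w = mat 1 - 2 *\<^sub>R proj_mat k w"

definition reflected_hessian ::
  "nat \<Rightarrow> (nat \<Rightarrow> real^'n) \<Rightarrow> real^'n^'n \<Rightarrow> real^'n^'n" where
  "reflected_hessian k w H = (1/2) *\<^sub>R (refl_mat k w ** H + H ** refl_mat k w)"

(* x: iterates, s: computed steps, v: exact eigenvectors, V: computed approximate eigenvectors,
   \<sigma>: regularization weights, \<delta>: subspace errors, \<xi>: residuals, \<eta>: forcing parameters *)
definition inexact_index_cubic_iteration ::
  "(real^'n \<Rightarrow> real) \<Rightarrow> nat \<Rightarrow> (nat \<Rightarrow> real) \<Rightarrow> (nat \<Rightarrow> real) \<Rightarrow> (nat \<Rightarrow> nat \<Rightarrow> real^'n) \<Rightarrow>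
   (nat \<Rightarrow> nat \<Rightarrow> real^'n) \<Rightarrow> (nat \<Rightarrow> real) \<Rightarrow> (nat \<Rightarrow> real^'n) \<Rightarrow> (nat \<Rightarrow> real^'n) \<Rightarrow>
   (nat \<Rightarrow> real^'n) \<Rightarrow> bool" where
  "inexact_index_cubic_iteration f k \<sigma> \<eta> v V \<delta> \<xi> s x \<longleftrightarrow>
     (\<forall>j. lowest_eigenvectors k (hessian f (x j)) (v j) \<and>
          orthonormal_family k (V j) \<and>
          \<delta> j = spectral_norm (proj_mat k (V j) - proj_mat k (v j)) \<and>
          \<xi> j = refl_mat k (V j) *v gradient f (x j)
                + reflected_hessian k (V j) (hessian f (x j)) *v s j
                + (\<sigma> j * norm (s j)) *\<^sub>R s j \<and>
          norm (\<xi> j) \<le> \<eta> j * norm (gradient f (x j)) \<and>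
          x (Suc j) = x j + s j)"

definition converges_linearly :: "(nat \<Rightarrow> 'a::real_normed_vector) \<Rightarrow> 'a \<Rightarrow> bool" where
  "converges_linearly x a \<longleftrightarrow> x \<longlonglongrightarrow> a \<and>
     (\<exists>q. 0 \<le> q \<and> q < 1 \<and> (\<forall>j. norm (x (Suc j) - a) \<le> q * norm (x j - a)))"

definition converges_superlinearly :: "(nat \<Rightarrow> 'a::real_normed_vector) \<Rightarrow> 'a \<Rightarrow> bool" where
  "converges_superlinearly x a \<longleftrightarrow> x \<longlonglongrightarrow> a \<and>
     (\<exists>\<theta> :: nat \<Rightarrow> real. \<theta> \<longlonglongrightarrow> 0 \<and> (\<forall>j. norm (x (Suc j) - a) \<le> \<theta> j * norm (x j - a)))"

definition converges_quadratically :: "(nat \<Rightarrow> 'a::real_normed_vector) \<Rightarrow> 'a \<Rightarrow> bool" where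
  "converges_quadratically x a \<longleftrightarrow> x \<longlonglongrightarrow> a \<and>
     (\<exists>C. \<forall>\<^sub>F j in sequentially. norm (x (Suc j) - a) \<le> C * (norm (x j - a))\<^sup>2)"

end

(* Write e for the error x_j - x', H for the Hessian at x_j, R for the exact and R' for the computed
   reflection. Since v_1, ..., v_k diagonalise H on its whole negative eigenspace, R H is |H|, which
   is bounded below by mu; the computed matrix B' differs from it by at most 2 L delta <= mu/2, so
   B' is still bounded below by mu/2. Pairing the step equation with s gives |s| <= K |grad f|.
   Adding B' e to both sides of the step equation gives
     B' (e + s) = (B' e - R' H e) + R' (H e - grad f) + xi - sigma |s| s,
   where the first bracket is (1/2)[H, R' - R] e, because R commutes with H, and the second is
   O(|e|^2) by Taylor expansion. All four claims follow from the resulting recursion for |e|. *)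
theory Submission
  imports Defs
begin

section \<open>Symmetry of the Hessian\<close>

lemma has_real_derivative_along_axis:
  fixes f :: "real^'n \<Rightarrow> real"
  assumes "f differentiable_on UNIV"
  shows "((\<lambda>u. f (a + u *\<^sub>R axis i 1)) has_real_derivative
           partial_deriv i f (a + u *\<^sub>R axis i 1)) (at u)"
proof -
  let ?D = "frechet_derivative f (at (a + u *\<^sub>R axis i 1))"
  have f: "(f has_derivative ?D) (at (a + u *\<^sub>R axis i 1))"
    using assms frechet_derivative_works by (auto simp: differentiable_on_def)
  have "((\<lambda>u. a + u *\<^sub>R (axis i 1 :: real^'n)) has_derivative (\<lambda>h. h *\<^sub>R axis i 1)) (at u)"
    by (auto intro!: derivative_eq_intros)
  from has_derivative_compose[OF this f] show ?thesis
    using linear_scale[OF has_derivative_linear[OF f]]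
    by (simp add: has_field_derivative_def partial_deriv_def mult_commute_abs)
qed

text \<open>The mean value theorem is applied twice: along axis i to the difference
  \<open>?\<phi>\<close> of two parallel copies of f, then along axis j to the partial derivative so
  obtained. The left-hand side is symmetric in i and j, which is what the next lemma
  exploits.\<close>

lemma second_difference_eq_partial_deriv:
  fixes f :: "real^'n \<Rightarrow> real"
  assumes f: "f differentiable_on UNIV" "partial_deriv i f differentiable_on UNIV" and "0 < t"
  shows "\<exists>u\<in>{0<..<t}. \<exists>w\<in>{0<..<t}.
    f (x + t *\<^sub>R axis i 1 + t *\<^sub>R axis j 1) - f (x + t *\<^sub>R axis i 1)
      - f (x + t *\<^sub>R axis j 1) + f x
    = t\<^sup>2 * partial_deriv j (partial_deriv i f) (x + u *\<^sub>R axis i 1 + w *\<^sub>R axis j 1)"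
proof -
  let ?\<phi> = "\<lambda>u. f (x + t *\<^sub>R axis j 1 + u *\<^sub>R axis i 1) - f (x + u *\<^sub>R axis i 1)"
  let ?\<phi>' = "\<lambda>u. partial_deriv i f (x + t *\<^sub>R axis j 1 + u *\<^sub>R axis i 1)
                - partial_deriv i f (x + u *\<^sub>R axis i 1)"
  have "\<And>u. (?\<phi> has_real_derivative ?\<phi>' u) (at u)"
    by (intro DERIV_diff has_real_derivative_along_axis f)
  with MVT2[OF \<open>0 < t\<close>, of ?\<phi> ?\<phi>'] obtain u where u: "0 < u" "u < t" "?\<phi> t - ?\<phi> 0 = t * ?\<phi>' u"
    by auto
  let ?\<psi> = "\<lambda>w. partial_deriv i f (x + u *\<^sub>R axis i 1 + w *\<^sub>R axis j 1)"
  let ?\<psi>' = "\<lambda>w. partial_deriv j (partial_deriv i f) (x + u *\<^sub>R axis i 1 + w *\<^sub>R axis j 1)"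
  have "\<And>w. (?\<psi> has_real_derivative ?\<psi>' w) (at w)"
    by (intro has_real_derivative_along_axis f)
  with MVT2[OF \<open>0 < t\<close>, of ?\<psi> ?\<psi>'] obtain w where w: "0 < w" "w < t" "?\<psi> t - ?\<psi> 0 = t * ?\<psi>' w"
    by auto
  have "?\<phi> t - ?\<phi> 0 = t * (t * ?\<psi>' w)"
    using u(3) w(3) by (simp add: algebra_simps)
  then show ?thesis
    using u(1,2) w(1,2) by (intro bexI[of _ u] bexI[of _ w]) (auto simp: power2_eq_square algebra_simps)
qed

text \<open>Evaluating the symmetric second difference in both orders and cancelling the squared
  step length shows that the two mixed partials agree at nearby points. Continuity carries this to x
  as the step shrinks.\<close>

lemma mixed_partial_derivs_commute:
  fixes f :: "real^'n \<Rightarrow> real"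
  assumes f: "f differentiable_on UNIV" and f': "\<And>i. partial_deriv i f differentiable_on UNIV"
    and cont: "\<And>i j. isCont (partial_deriv j (partial_deriv i f)) x"
  shows "partial_deriv j (partial_deriv i f) x = partial_deriv i (partial_deriv j f) x"
proof -
  let ?e = "\<lambda>i. axis i 1 :: real^'n"
  let ?P = "\<lambda>i j u w. x + u *\<^sub>R ?e i + w *\<^sub>R ?e j"
  \<comment> \<open>Any positive null sequence would do; the intermediate points then form sequences
    squeezed towards x.\<close>
  define t where "t n = 1 / (real n + 1)" for n
  have t: "t n > 0" "t \<longlonglongrightarrow> 0" for n
    using LIMSEQ_inverse_real_of_nat by (auto simp: t_def[abs_def] inverse_eq_divide algebra_simps)
  have "\<exists>u w u' w'. u \<in> {0<..<t n} \<and> w \<in> {0<..<t n} \<and> u' \<in> {0<..<t n} \<and> w' \<in> {0<..<t n} \<and>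
     partial_deriv j (partial_deriv i f) (?P i j u w) =
     partial_deriv i (partial_deriv j f) (?P j i u' w')" for n
  proof -
    from second_difference_eq_partial_deriv[OF f f' t(1), of n x i j]
    obtain u w where 1: "u\<in>{0<..<t n}" "w\<in>{0<..<t n}"
      "f (x + t n *\<^sub>R ?e i + t n *\<^sub>R ?e j) - f (x + t n *\<^sub>R ?e i) - f (x + t n *\<^sub>R ?e j) + f x
       = (t n)\<^sup>2 * partial_deriv j (partial_deriv i f) (?P i j u w)" by auto
    from second_difference_eq_partial_deriv[OF f f' t(1), of n x j i]
    obtain u' w' where 2: "u'\<in>{0<..<t n}" "w'\<in>{0<..<t n}"
      "f (x + t n *\<^sub>R ?e j + t n *\<^sub>R ?e i) - f (x + t n *\<^sub>R ?e j) - f (x + t n *\<^sub>R ?e i) + f x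
       = (t n)\<^sup>2 * partial_deriv i (partial_deriv j f) (?P j i u' w')" by auto
    have "(t n)\<^sup>2 * partial_deriv j (partial_deriv i f) (?P i j u w)
        = (t n)\<^sup>2 * partial_deriv i (partial_deriv j f) (?P j i u' w')"
      using 1(3) 2(3) by (simp add: algebra_simps)
    with 1 2 t(1)[of n] show ?thesis by auto
  qed
  then obtain u w u' w' where uw: "\<And>n. u n \<in> {0<..<t n}" "\<And>n. w n \<in> {0<..<t n}"
    "\<And>n. u' n \<in> {0<..<t n}" "\<And>n. w' n \<in> {0<..<t n}" and
    eq: "\<And>n. partial_deriv j (partial_deriv i f) (?P i j (u n) (w n)) =
         partial_deriv i (partial_deriv j f) (?P j i (u' n) (w' n))" by metis
  have lim0: "a \<longlonglongrightarrow> 0" if "\<And>n. a n \<in> {0<..<t n}" for a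
    by (rule tendsto_sandwich[OF _ _ tendsto_const t(2)])
      (use that in \<open>auto intro!: eventuallyI less_imp_le\<close>)
  have lim: "(\<lambda>n. ?P i j (a n) (b n)) \<longlonglongrightarrow> x"
    if "\<And>n. a n \<in> {0<..<t n}" "\<And>n. b n \<in> {0<..<t n}" for a b i j
    using tendsto_add[OF tendsto_add[OF tendsto_const tendsto_scaleR[OF lim0[OF that(1)] tendsto_const]]
       tendsto_scaleR[OF lim0[OF that(2)] tendsto_const], of x "?e i" "?e j"] by simp
  have "(\<lambda>n. partial_deriv j (partial_deriv i f) (?P i j (u n) (w n)))
      \<longlonglongrightarrow> partial_deriv j (partial_deriv i f) x"
    by (rule isCont_tendsto_compose[OF cont lim]) (fact uw)+
  moreover have "(\<lambda>n. partial_deriv i (partial_deriv j f) (?P j i (u' n) (w' n)))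
      \<longlonglongrightarrow> partial_deriv i (partial_deriv j f) x"
    by (rule isCont_tendsto_compose[OF cont lim]) (fact uw)+
  ultimately show ?thesis
    unfolding eq by (rule LIMSEQ_unique)
qed

section \<open>The Hessian as derivative of the gradient and as matrix of second partials\<close>

lemma gradient_has_derivative_hessian:
  assumes "C_class 2 f"
  shows "(gradient f has_derivative (\<lambda>h. hessian f x *v h)) (at x)"
proof -
  have "partial_deriv i f differentiable at x" for i
    using assms by (auto simp: numeral_2_eq_2 differentiable_on_def)
  then have "(\<lambda>y. gradient f y $ i) differentiable at x" for i
    by (simp add: gradient_def)
  then have "(\<lambda>y. gradient f y \<bullet> b) differentiable at x" if "b \<in> Basis" for b
    using that by (auto simp: Basis_vec_def inner_axis)
  then have "gradient f differentiable at x"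
    by (subst differentiable_componentwise_within) blast
  then show ?thesis
    unfolding hessian_def by (simp add: jacobian_works)
qed

lemma hessian_nth:
  assumes "C_class 2 f"
  shows "hessian f x $ i $ j = partial_deriv j (partial_deriv i f) x"
proof -
  have "((\<lambda>y. gradient f y $ i) has_derivative (\<lambda>h. (hessian f x *v h) $ i)) (at x)"
    by (intro bounded_linear.has_derivative[OF bounded_linear_vec_nth]
        gradient_has_derivative_hessian assms)
  then have "(partial_deriv i f has_derivative (\<lambda>h. (hessian f x *v h) $ i)) (at x)"
    by (simp add: gradient_def)
  then show ?thesis
    unfolding partial_deriv_def[of j]
    by (simp add: frechet_derivative_at[symmetric] matrix_vector_mul_component inner_axis)
qed

lemma transpose_hessian:
  assumes "C_class 2 f"
  shows "transpose (hessian f x) = hessian f x"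
proof -
  have "isCont (partial_deriv j (partial_deriv i f)) x" for i j
    using assms by (auto simp: numeral_2_eq_2 continuous_on_eq_continuous_at)
  moreover have "f differentiable_on UNIV" "partial_deriv i f differentiable_on UNIV" for i
    using assms by (auto simp: numeral_2_eq_2)
  ultimately have "partial_deriv j (partial_deriv i f) x = partial_deriv i (partial_deriv j f) x" for i j
    by (intro mixed_partial_derivs_commute)
  then show ?thesis
    by (simp add: vec_eq_iff transpose_def hessian_nth[OF assms])
qed

section \<open>Orthonormal eigenbases of symmetric matrices\<close>

lemma inner_matrix_vector_symmetric:
  fixes A :: "real^'n^'n"
  assumes "transpose A = A"
  shows "(A *v x) \<bullet> y = x \<bullet> (A *v y)"
  using assms by (metis dot_lmul_matrix vector_transpose_matrix)

text \<open>A maximiser u of the Rayleigh quotient on the orthogonal complement W is an eigenvector: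
  its residual z = A u - l u lies in W, and perturbing u in the direction z would increase the
  quotient unless z = 0.\<close>
lemma eigenvector_orthogonal_to_eigenvectors:
  fixes A :: "real^'n^'n"
  assumes sym: "transpose A = A" and "m < CARD('n)"
    and eig: "\<forall>i<m. \<exists>l. A *v w i = l *\<^sub>R w i"
  shows "\<exists>u l. norm u = 1 \<and> (\<forall>i<m. u \<bullet> w i = 0) \<and> A *v u = l *\<^sub>R u"
proof -
  define W where "W = {u. \<forall>i<m. u \<bullet> w i = 0}"
  have W_add: "a + c *\<^sub>R b \<in> W" if "a \<in> W" "b \<in> W" for a b c
    using that by (simp add: W_def inner_left_distrib)
  have W_inv: "A *v u \<in> W" if "u \<in> W" for u
    unfolding W_def
  proof (intro CollectI allI impI)
    fix i assume "i < m"
    then obtain l where "A *v w i = l *\<^sub>R w i" using eig by blast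
    then show "(A *v u) \<bullet> w i = 0"
      using that \<open>i < m\<close> by (simp add: inner_matrix_vector_symmetric[OF sym] W_def)
  qed
  have "closed W"
    unfolding W_def by (intro closed_Collect_all closed_Collect_imp open_Collect_const closed_Collect_eq continuous_intros)
  then have "compact (W \<inter> sphere 0 1)"
    by (intro closed_Int_compact compact_sphere)
  moreover have "W \<inter> sphere 0 1 \<noteq> {}"
  proof -
    have "dim (w ` {..<m}) \<le> card (w ` {..<m})" by (rule dim_le_card) (auto simp: span_superset)
    also have "\<dots> \<le> m" using card_image_le[of "{..<m}" w] by simp
    finally have "span (w ` {..<m}) \<noteq> UNIV"
      using \<open>m < CARD('n)\<close> dim_span[of "w ` {..<m}"] by (metis dim_UNIV DIM_cart DIM_real mult_1_right not_le)
    from span_not_UNIV_orthogonal[OF this] obtain a where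
      "a \<noteq> 0" "\<forall>y\<in>span (w ` {..<m}). a \<bullet> y = 0" by blast
    then have "a /\<^sub>R norm a \<in> W \<inter> sphere 0 1"
      by (auto simp: W_def span_base)
    then show ?thesis by blast
  qed
  moreover have "continuous_on (W \<inter> sphere 0 1) (\<lambda>u. u \<bullet> (A *v u))"
    by (intro continuous_intros linear_continuous_on matrix_vector_mul_bounded_linear)
  ultimately obtain u where u: "u \<in> W" "norm u = 1" and
    max: "\<And>y. y \<in> W \<Longrightarrow> norm y = 1 \<Longrightarrow> y \<bullet> (A *v y) \<le> u \<bullet> (A *v u)"
    using continuous_attains_sup by (metis (no_types, lifting) Int_iff mem_sphere_0)
  define l where "l = u \<bullet> (A *v u)"
  have rayleigh: "y \<bullet> (A *v y) \<le> l * (y \<bullet> y)" if "y \<in> W" for y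
  proof (cases "y = 0")
    case False
    define z where "z = y /\<^sub>R norm y"
    have "y = norm y *\<^sub>R z" "norm z = 1" using False by (auto simp: z_def)
    moreover have "z \<in> W" using that by (simp add: W_def z_def)
    ultimately have "y \<bullet> (A *v y) = (norm y)\<^sup>2 * (z \<bullet> (A *v z))"
      by (metis (no_types, opaque_lifting) inner_scaleR_left inner_scaleR_right matrix_vector_mult_scaleR mult.assoc power2_eq_square)
    also have "\<dots> \<le> (norm y)\<^sup>2 * l"
      unfolding l_def by (intro mult_left_mono max \<open>z \<in> W\<close> \<open>norm z = 1\<close>) auto
    finally show ?thesis by (simp add: power2_norm_eq_inner mult.commute)
  qed simp
  define z where "z = A *v u - l *\<^sub>R u"
  have "z \<in> W"
    using W_add[OF W_inv[OF u(1)] u(1), of "-l"] by (simp add: z_def)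
  define c where "c = z \<bullet> (A *v z) - l * (z \<bullet> z)"
  \<comment> \<open>Along the line u + t z, the Rayleigh defect has no constant term, since u
    attains the maximum l, and its linear coefficient is twice the squared norm of z.\<close>
  have ineq: "2 * t * (z \<bullet> z) + t\<^sup>2 * c \<le> 0" for t
  proof -
    have "(u + t *\<^sub>R z) \<bullet> (A *v (u + t *\<^sub>R z)) - l * ((u + t *\<^sub>R z) \<bullet> (u + t *\<^sub>R z))
        = (u \<bullet> (A *v u) - l * (u \<bullet> u)) + 2 * t * (z \<bullet> (A *v u) - l * (z \<bullet> u)) + t\<^sup>2 * c"
      using inner_matrix_vector_symmetric[OF sym, of u z]
      by (simp add: c_def matrix_vector_right_distrib matrix_vector_mult_scaleR inner_add_left
          inner_add_right inner_commute power2_eq_square algebra_simps)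
    moreover have "z \<bullet> (A *v u) - l * (z \<bullet> u) = z \<bullet> z"
      by (simp add: z_def inner_diff_right)
    moreover have "u \<bullet> (A *v u) - l * (u \<bullet> u) = 0" using u(2) by (simp add: norm_eq_1 l_def)
    ultimately have "(u + t *\<^sub>R z) \<bullet> (A *v (u + t *\<^sub>R z)) - l * ((u + t *\<^sub>R z) \<bullet> (u + t *\<^sub>R z))
        = 2 * t * (z \<bullet> z) + t\<^sup>2 * c"
      by (simp only: add_0_left)
    then show ?thesis
      using rayleigh[OF W_add[OF u(1) \<open>z \<in> W\<close>, of t]] by linarith
  qed
  have "z \<bullet> z = 0"
  proof (rule ccontr)
    assume "z \<bullet> z \<noteq> 0"
    then have pos: "z \<bullet> z > 0" by (metis inner_eq_zero_iff inner_gt_zero_iff)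
    \<comment> \<open>This t is so small that the quadratic term cannot cancel the linear one; the
      summand 1 covers c = 0.\<close>
    define t where "t = (z \<bullet> z) / (\<bar>c\<bar> + 1)"
    have "t > 0" using pos by (simp add: t_def)
    have "t * \<bar>c\<bar> < z \<bullet> z" using pos by (simp add: t_def field_simps)
    moreover have minus_t: "- (t * \<bar>c\<bar>) \<le> t * c"
      using \<open>t > 0\<close> abs_ge_minus_self[of "t * c"] by (simp add: abs_mult)
    ultimately have "2 * (z \<bullet> z) + t * c > 0"
      using pos \<open>t > 0\<close> minus_t
      by linarith
    then have "t * (2 * (z \<bullet> z) + t * c) > 0" using \<open>t > 0\<close> by simp
    then show False using ineq[of t] by (simp add: power2_eq_square algebra_simps)
  qed
  then have "A *v u = l *\<^sub>R u" by (simp add: z_def)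
  then show ?thesis using u by (auto simp: W_def)
qed

text \<open>Vectors are added one at a time, by induction on the number still missing. Starting from
  a given family matters: with repeated eigenvalues, an arbitrary eigenbasis need not contain the
  eigenvectors chosen by the iteration.\<close>

lemma extend_to_orthonormal_eigenbasis:
  fixes A :: "real^'n^'n"
  assumes sym: "transpose A = A" and "m \<le> CARD('n)"
    and "orthonormal_family m w" "\<forall>i<m. \<exists>l. A *v w i = l *\<^sub>R w i"
  shows "\<exists>w'. orthonormal_family CARD('n) w' \<and> (\<forall>i<m. w' i = w i) \<and>
    (\<forall>i<CARD('n). \<exists>l. A *v w' i = l *\<^sub>R w' i)"
  using assms(2-4)
proof (induction "CARD('n) - m" arbitrary: m w)
  case 0
  then show ?case by (intro exI[of _ w]) auto
next
  case (Suc d)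
  then have "m < CARD('n)" by simp
  from eigenvector_orthogonal_to_eigenvectors[OF sym this Suc.prems(3)] obtain u l where
    u: "norm u = 1" "\<forall>i<m. u \<bullet> w i = 0" "A *v u = l *\<^sub>R u" by blast
  have on: "orthonormal_family (Suc m) (w(m := u))"
    using Suc.prems(2) u(1,2)
    by (auto simp: orthonormal_family_def less_Suc_eq norm_eq_1 inner_commute)
  have eig: "\<forall>i<Suc m. \<exists>l. A *v (w(m := u)) i = l *\<^sub>R (w(m := u)) i"
    using Suc.prems(3) u(3) by (auto simp: less_Suc_eq)
  have "d = CARD('n) - Suc m" "Suc m \<le> CARD('n)"
    using Suc.hyps(2) \<open>m < CARD('n)\<close> by simp_all
  from Suc.hyps(1)[OF this on eig] obtain w' where "orthonormal_family CARD('n) w'"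
    "\<forall>i<Suc m. w' i = (w(m := u)) i" "\<forall>i<CARD('n). \<exists>l. A *v w' i = l *\<^sub>R w' i"
    by blast
  then show ?case by (intro exI[of _ w']) auto
qed

text \<open>Orthonormal vectors are independent, and as many as the dimension span the space. The
  remainder z of the expansion is orthogonal to all of them, hence to itself.\<close>

lemma orthonormal_basis_expansion:
  fixes w :: "nat \<Rightarrow> real^'n"
  assumes "orthonormal_family CARD('n) w"
  shows "h = (\<Sum>i<CARD('n). (h \<bullet> w i) *\<^sub>R w i)"
proof -
  let ?B = "w ` {..<CARD('n)}"
  have w: "w i \<bullet> w l = (if i = l then 1 else 0)" if "i < CARD('n)" "l < CARD('n)" for i l
    using assms that by (simp add: orthonormal_family_def)
  have inj: "inj_on w {..<CARD('n)}"
    by (rule inj_onI) (metis w lessThan_iff zero_neq_one)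
  have "independent ?B"
  proof (rule pairwise_orthogonal_independent)
    show "pairwise orthogonal ?B"
      using w by (auto simp: pairwise_def orthogonal_def)
    show "0 \<notin> ?B"
      using w by (metis imageE inner_zero_left lessThan_iff zero_neq_one)
  qed
  then have "span ?B = UNIV"
    using card_ge_dim_independent[of ?B UNIV] card_image[OF inj] by (auto simp: dim_UNIV)
  moreover define z where "z = h - (\<Sum>i<CARD('n). (h \<bullet> w i) *\<^sub>R w i)"
  have "z \<bullet> w i = 0" if "i < CARD('n)" for i
    using that by (simp add: z_def inner_diff_left inner_sum_left w if_distrib cong: if_cong)
  then have "orthogonal z b" if "b \<in> ?B" for b
    using that by (auto simp: orthogonal_def)
  ultimately have "orthogonal z z"
    by (intro orthogonal_to_span[of z ?B z]) auto
  then show ?thesis by (simp add: orthogonal_def z_def)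
qed

lemma orthonormal_basis_inner:
  fixes w :: "nat \<Rightarrow> real^'n"
  assumes "orthonormal_family CARD('n) w"
  shows "h \<bullet> y = (\<Sum>i<CARD('n). (h \<bullet> w i) * (y \<bullet> w i))"
proof -
  have "h \<bullet> y = (\<Sum>i<CARD('n). (h \<bullet> w i) *\<^sub>R w i) \<bullet> y"
    using orthonormal_basis_expansion[OF assms, of h] by simp
  then show ?thesis
    by (simp add: inner_sum_left inner_commute[of y])
qed

section \<open>Characteristic polynomial and the sorted list of eigenvalues\<close>

lemma poly_charpoly: "poly (charpoly A) t = det (mat t - A)"
proof -
  \<comment> \<open>The signs of the permutations enter the polynomial determinant as integer
    constants, through which evaluation has to pass.\<close>
  have "poly (of_int c) t = of_int c" for c :: int
    by (metis of_int_poly poly_pCons poly_0 mult_zero_right add.right_neutral)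
  then show ?thesis
    unfolding charpoly_def det_def
    by (auto simp: poly_sum poly_prod mat_def intro!: sum.cong prod.cong)
qed

text \<open>With the eigenvectors as columns of Q, (t I - A) Q = Q D for a diagonal D. Taking
  determinants and cancelling det Q gives equality at every t, hence equality of
  polynomials.\<close>

lemma charpoly_eigenbasis:
  fixes A :: "real^'n^'n"
  assumes on: "orthonormal_family CARD('n) w"
    and eig: "\<And>i. i < CARD('n) \<Longrightarrow> A *v w i = l i *\<^sub>R w i"
  shows "charpoly A = (\<Prod>i<CARD('n). [:- l i, 1:])"
proof -
  \<comment> \<open>The eigenvectors are numbered by naturals but matrix columns by the type
    \<open>'n\<close>; e translates between the two.\<close>
  obtain e :: "'n \<Rightarrow> nat" where e: "bij_betw e UNIV {..<CARD('n)}"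
    using ex_bij_betw_finite_nat[of "UNIV :: 'n set"] by (auto simp: atLeast0LessThan)
  have e_less: "e b < CARD('n)" and e_inj: "e a = e b \<longleftrightarrow> a = b" for a b
    using e by (auto simp: bij_betw_def inj_on_def)
  define Q where "Q = (\<chi> a b. w (e b) $ a)"
  have "transpose Q ** Q = mat 1"
    using on e_less e_inj
    by (auto simp: vec_eq_iff matrix_matrix_mult_def transpose_def mat_def Q_def
        orthonormal_family_def inner_vec_def)
  then have "det (transpose Q) * det Q = 1" by (metis det_mul det_I)
  then have "det Q \<noteq> 0" by auto
  have "poly (charpoly A) t = poly (\<Prod>i<CARD('n). [:- l i, 1:]) t" for t
  proof -
    define D :: "real^'n^'n" where "D = (\<chi> a b. if a = b then t - l (e a) else 0)"
    have "(A *v w (e b)) $ a = l (e b) * w (e b) $ a" for a b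
      using eig[OF e_less] by (simp add: vec_eq_iff)
    then have "(\<Sum>c\<in>UNIV. A $ a $ c * w (e b) $ c) = l (e b) * w (e b) $ a" for a b
      by (simp add: matrix_vector_mult_def)
    moreover have "(mat t - A) $ a $ c * y = (if a = c then t * y else 0) - A $ a $ c * y" for a c y
      by (simp add: mat_def left_diff_distrib)
    ultimately have "((mat t - A) ** Q) $ a $ b = t * w (e b) $ a - l (e b) * w (e b) $ a" for a b
      by (simp add: matrix_matrix_mult_def Q_def sum_subtractf)
    moreover have "(Q ** D) $ a $ b = t * w (e b) $ a - l (e b) * w (e b) $ a" for a b
      by (simp add: matrix_matrix_mult_def Q_def D_def if_distrib cong: if_cong)
        (simp add: algebra_simps)
    ultimately have "(mat t - A) ** Q = Q ** D"
      by (simp add: vec_eq_iff)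
    then have "det (mat t - A) * det Q = det Q * det D" by (metis det_mul)
    then have "det (mat t - A) = det D" using \<open>det Q \<noteq> 0\<close> by simp
    also have "\<dots> = (\<Prod>a\<in>UNIV. t - l (e a))" by (subst det_diagonal) (auto simp: D_def)
    also have "\<dots> = (\<Prod>i<CARD('n). t - l i)" by (rule prod.reindex_bij_betw[OF e])
    finally show ?thesis by (simp add: poly_charpoly poly_prod)
  qed
  then show ?thesis by (simp add: poly_eq_poly_eq_iff[symmetric] fun_eq_iff)
qed

text \<open>This links the algebraic definition of \<open>eigvals\<close>, by roots of the
  characteristic polynomial, to actual eigenvectors. Only multisets can be compared, because the
  eigenbasis need not be sorted.\<close>

lemma mset_eigvals_eigenbasis:
  fixes A :: "real^'n^'n"
  assumes "orthonormal_family CARD('n) w"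
    and "\<And>i. i < CARD('n) \<Longrightarrow> A *v w i = l i *\<^sub>R w i"
  shows "mset (eigvals A) = mset (map l [0..<CARD('n)])"
proof -
  have "mset (eigvals A) = proots (\<Prod>i<CARD('n). [:- l i, 1:])"
    by (simp add: eigvals_def charpoly_eigenbasis[OF assms])
  also have "\<dots> = (\<Sum>i<CARD('n). {#l i#})"
    by (subst proots_prod) auto
  also have "\<dots> = mset (map l [0..<CARD('n)])"
    by (simp add: sum_unfold_sum_mset lessThan_atLeast0)
  finally show ?thesis .
qed

text \<open>The vectors v use up the first k entries of \<open>eigvals A\<close>, so the vectors
  added to complete the basis carry exactly the entries from position k on. Their order is unknown,
  hence the existential j.\<close>

lemma lowest_eigenvectors_extend:
  fixes A :: "real^'n^'n"
  assumes sym: "transpose A = A" and k: "k \<le> CARD('n)" and v: "lowest_eigenvectors k A v"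
  obtains w l where "orthonormal_family CARD('n) w"
    "\<And>i. i < CARD('n) \<Longrightarrow> A *v w i = l i *\<^sub>R w i"
    "\<And>i. i < k \<Longrightarrow> w i = v i" "\<And>i. i < k \<Longrightarrow> l i = eigvals A ! i"
    "\<And>i. k \<le> i \<Longrightarrow> i < CARD('n) \<Longrightarrow> \<exists>j\<ge>k. j < CARD('n) \<and> l i = eigvals A ! j"
proof -
  have on: "orthonormal_family k v" and eig: "\<And>i. i < k \<Longrightarrow> A *v v i = (eigvals A ! i) *\<^sub>R v i"
    using v by (auto simp: lowest_eigenvectors_def)
  have "orthonormal_family k v" "\<forall>i<k. \<exists>l. A *v v i = l *\<^sub>R v i"
    using v by (auto simp: lowest_eigenvectors_def)
  from extend_to_orthonormal_eigenbasis[OF sym k this] obtain w l where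
    w: "orthonormal_family CARD('n) w" "\<And>i. i < k \<Longrightarrow> w i = v i"
    and l: "\<And>i. i < CARD('n) \<Longrightarrow> A *v w i = l i *\<^sub>R w i"
    by metis
  let ?n = "CARD('n)"
  have ms: "mset (eigvals A) = mset (map l [0..<?n])"
    by (rule mset_eigvals_eigenbasis[OF w(1) l])
  have len: "length (eigvals A) = ?n"
    using arg_cong[OF ms, of size] by (simp only: size_mset length_map length_upt diff_zero)
  \<comment> \<open>Both scalars are eigenvalues of the same nonzero vector.\<close>
  have lk: "l i = eigvals A ! i" if "i < k" for i
  proof -
    have "v i \<noteq> 0" using on that by (metis inner_zero_left orthonormal_family_def zero_neq_one)
    moreover have "i < ?n" using that k by simp
    then have "l i *\<^sub>R v i = A *v v i"
      using l[of i] unfolding w(2)[OF that] by simp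
    then have "l i *\<^sub>R v i = (eigvals A ! i) *\<^sub>R v i"
      unfolding eig[OF that] .
    ultimately show ?thesis by (rule scaleR_right_imp_eq)
  qed
  have "[0..<?n] = [0..<k] @ [k..<?n]"
    using upt_add_eq_append[of 0 k "?n - k"] k by simp
  moreover have "map l [0..<k] = take k (eigvals A)"
    using len k by (intro nth_equalityI) (simp_all add: lk)
  \<comment> \<open>Both multisets of eigenvalues share the first k entries; cancelling these leaves
    the tails.\<close>
  ultimately have "mset (take k (eigvals A) @ drop k (eigvals A)) = mset (take k (eigvals A) @ map l [k..<?n])"
    unfolding append_take_drop_id ms by (simp only: map_append)
  then have "mset (drop k (eigvals A)) = mset (map l [k..<?n])"
    by (simp only: mset_append add_left_cancel)
  then have set_eq: "set (drop k (eigvals A)) = l ` {k..<?n}"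
    by (metis set_mset_mset set_map set_upt)
  have "\<exists>j\<ge>k. j < ?n \<and> l i = eigvals A ! j" if i: "k \<le> i" "i < ?n" for i
  proof -
    have "l i \<in> set (drop k (eigvals A))" using set_eq i by auto
    then obtain j where "j < ?n - k" "l i = eigvals A ! (k + j)"
      using len by (auto simp: in_set_conv_nth)
    then show ?thesis by (intro exI[of _ "k + j"]) auto
  qed
  with that[of w l] w l lk show ?thesis by simp
qed

text \<open>In an eigenbasis, the squared norm of A h weights the squared coordinates of h by
  squared eigenvalues, each at most the square of L.\<close>

lemma norm_symmetric_matrix_vector_le:
  fixes A :: "real^'n^'n"
  assumes sym: "transpose A = A" and bound: "\<And>i. i < CARD('n) \<Longrightarrow> \<bar>eigvals A ! i\<bar> \<le> L"
  shows "norm (A *v h) \<le> L * norm h"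
proof -
  \<comment> \<open>With k = 0 no vector is prescribed, and the extension lemma yields some
    eigenbasis.\<close>
  obtain w l where w: "orthonormal_family CARD('n) w"
    and l: "\<And>i. i < CARD('n) \<Longrightarrow> A *v w i = l i *\<^sub>R w i"
    and "\<And>i. i < CARD('n) \<Longrightarrow> \<exists>j<CARD('n). l i = eigvals A ! j"
    using lowest_eigenvectors_extend[OF sym, of 0]
    by (auto simp: lowest_eigenvectors_def orthonormal_family_def)
  with bound have lL: "\<bar>l i\<bar> \<le> L" if "i < CARD('n)" for i using that by metis
  \<comment> \<open>The index 0 is legitimate because the dimension is positive.\<close>
  have "0 \<le> L" using lL[of 0] by (meson abs_ge_zero order_trans zero_less_card_finite)
  then have lL_sq: "(l i)\<^sup>2 \<le> L\<^sup>2" if "i < CARD('n)" for i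
    using lL[OF that] by (simp add: abs_le_square_iff[symmetric])
  have "(norm (A *v h))\<^sup>2 = (\<Sum>i<CARD('n). (l i)\<^sup>2 * (h \<bullet> w i)\<^sup>2)"
    unfolding power2_norm_eq_inner orthonormal_basis_inner[OF w, of "A *v h" "A *v h"]
    by (simp add: inner_matrix_vector_symmetric[OF sym] l power2_eq_square mult_ac)
  also have "\<dots> \<le> (\<Sum>i<CARD('n). L\<^sup>2 * (h \<bullet> w i)\<^sup>2)"
    by (intro sum_mono mult_right_mono lL_sq) simp_all
  also have "\<dots> = L\<^sup>2 * (h \<bullet> h)"
    unfolding orthonormal_basis_inner[OF w, of h h] sum_distrib_left by (simp add: power2_eq_square)
  also have "\<dots> = (L * norm h)\<^sup>2"
    by (simp add: power_mult_distrib power2_norm_eq_inner)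
  finally show ?thesis
    by (rule power2_le_imp_le) (simp add: \<open>0 \<le> L\<close>)
qed

section \<open>Exact and computed reflections\<close>

lemma proj_mat_mult:
  "proj_mat k w *v h = (\<Sum>i<k. (h \<bullet> w i) *\<^sub>R w i)"
proof -
  have "(proj_mat k w *v h) $ a = (\<Sum>i<k. (h \<bullet> w i) *\<^sub>R w i) $ a" for a
    unfolding proj_mat_def matrix_vector_mult_def inner_vec_def sum_component
    by (simp add: sum_distrib_left sum_distrib_right sum.swap[of _ "{..<k}"] mult_ac)
  then show ?thesis by (simp add: vec_eq_iff)
qed

lemma refl_mat_mult: "refl_mat k w *v h = h - 2 *\<^sub>R (proj_mat k w *v h)"
  by (simp add: refl_mat_def matrix_vector_mult_diff_rdistrib scaleR_matrix_vector_assoc)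

lemma transpose_refl_mat: "transpose (refl_mat k w) = refl_mat k w"
  by (auto simp: refl_mat_def proj_mat_def transpose_def vec_eq_iff mat_def mult.commute)

text \<open>Orthonormality gives p . p = h . p for the projection p of h, so the cross term and the
  quadratic term of |h - 2 p|^2 cancel.\<close>

lemma norm_refl_mat_mult:
  assumes "orthonormal_family k w"
  shows "norm (refl_mat k w *v h) = norm h"
proof -
  let ?p = "proj_mat k w *v h"
  have "?p \<bullet> w i = h \<bullet> w i" if "i < k" for i
  proof -
    have "?p \<bullet> w i = (\<Sum>j<k. (h \<bullet> w j) * (w j \<bullet> w i))"
      by (simp add: proj_mat_mult inner_sum_left)
    also have "\<dots> = (\<Sum>j<k. if j = i then h \<bullet> w i else 0)"
      using assms that by (intro sum.cong) (auto simp: orthonormal_family_def)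
    finally show ?thesis using that by simp
  qed
  then have "?p \<bullet> ?p = h \<bullet> ?p"
    by (simp add: proj_mat_mult[of k w h] inner_sum_right)
  then show ?thesis
    by (simp add: norm_eq refl_mat_mult inner_diff_left inner_diff_right inner_commute)
qed

lemma reflected_hessian_mult:
  "reflected_hessian k w H *v h = (1/2) *\<^sub>R (refl_mat k w *v (H *v h) + H *v (refl_mat k w *v h))"
  by (simp add: reflected_hessian_def scaleR_matrix_vector_assoc[symmetric]
      matrix_vector_mult_add_rdistrib matrix_vector_mul_assoc)

lemma norm_matrix_vector_le_spectral_norm: "norm (A *v h) \<le> spectral_norm A * norm h"
  unfolding spectral_norm_def by (rule onorm) (rule matrix_vector_mul_bounded_linear)

lemma spectral_norm_nonneg: "0 \<le> spectral_norm A"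
  unfolding spectral_norm_def by (rule onorm_pos_le) (rule matrix_vector_mul_bounded_linear)

text \<open>The identity parts cancel, leaving minus twice the difference of the projections; hence
  the factor 2.\<close>

lemma norm_refl_mat_diff_le:
  "norm (refl_mat k w *v h - refl_mat k v *v h) \<le> 2 * spectral_norm (proj_mat k w - proj_mat k v) * norm h"
proof -
  have "refl_mat k w *v h - refl_mat k v *v h = - (2 *\<^sub>R ((proj_mat k w - proj_mat k v) *v h))"
    by (simp add: refl_mat_mult matrix_vector_mult_diff_rdistrib scaleR_diff_right)
  then have "norm (refl_mat k w *v h - refl_mat k v *v h) = 2 * norm ((proj_mat k w - proj_mat k v) *v h)"
    by (simp only: norm_minus_cancel) simp
  then show ?thesis
    using norm_matrix_vector_le_spectral_norm[of "proj_mat k w - proj_mat k v" h] by simp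
qed

text \<open>Symmetry moves A onto v_i inside the inner product, so A P h and P A h have the same
  coefficients, the eigenvalue times h . v_i.\<close>

lemma refl_mat_lowest_eigenvectors_commute:
  assumes sym: "transpose A = A" and v: "lowest_eigenvectors k A v"
  shows "A *v (refl_mat k v *v h) = refl_mat k v *v (A *v h)"
proof -
  have eig: "A *v v i = (eigvals A ! i) *\<^sub>R v i" if "i < k" for i
    using v that by (auto simp: lowest_eigenvectors_def)
  have "A *v (proj_mat k v *v h) = proj_mat k v *v (A *v h)"
    by (simp add: proj_mat_mult linear_sum[OF matrix_vector_mul_linear] matrix_vector_mult_scaleR
        eig inner_matrix_vector_symmetric[OF sym] mult.commute)
  then show ?thesis
    by (simp add: refl_mat_mult matrix_vector_mult_diff_distrib matrix_vector_mult_scaleR)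
qed

text \<open>In the extended eigenbasis the reflection flips the sign of the first k coordinates
  only. The product is therefore diagonal with entries - l_i for i < k and l_i otherwise, all at
  least \<mu>.\<close>

lemma refl_mat_lowest_eigenvectors_coercive:
  fixes A :: "real^'n^'n"
  assumes sym: "transpose A = A" and k: "k \<le> CARD('n)" and v: "lowest_eigenvectors k A v"
    and neg: "\<And>i. i < k \<Longrightarrow> eigvals A ! i \<le> - \<mu>"
    and pos: "\<And>i. k \<le> i \<Longrightarrow> i < CARD('n) \<Longrightarrow> \<mu> \<le> eigvals A ! i"
  shows "\<mu> * (norm h)\<^sup>2 \<le> h \<bullet> (refl_mat k v *v (A *v h))"
proof -
  obtain w l where w: "orthonormal_family CARD('n) w"
    and l: "\<And>i. i < CARD('n) \<Longrightarrow> A *v w i = l i *\<^sub>R w i"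
    and wv: "\<And>i. i < k \<Longrightarrow> w i = v i" and l_neg: "\<And>i. i < k \<Longrightarrow> l i = eigvals A ! i"
    and l_pos: "\<And>i. k \<le> i \<Longrightarrow> i < CARD('n) \<Longrightarrow> \<exists>j\<ge>k. j < CARD('n) \<and> l i = eigvals A ! j"
    using lowest_eigenvectors_extend[OF sym k v] by blast
  have refl_w: "refl_mat k v *v w i = (if i < k then - w i else w i)" if "i < CARD('n)" for i
  proof -
    have "proj_mat k v *v w i = (\<Sum>j<k. (if i = j then w i else 0))"
      unfolding proj_mat_mult
    proof (rule sum.cong)
      fix j assume "j \<in> {..<k}"
      then have "j < CARD('n)" and "v j = w j" using k wv by auto
      then show "(w i \<bullet> v j) *\<^sub>R v j = (if i = j then w i else 0)"
        using w that by (auto simp: orthonormal_family_def)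
    qed simp
    then show ?thesis by (auto simp: refl_mat_mult scaleR_2)
  qed
  have coeff: "(refl_mat k v *v (A *v h)) \<bullet> w i = (if i < k then - l i else l i) * (h \<bullet> w i)"
    if "i < CARD('n)" for i
    using that l[OF that]
    by (simp add: inner_matrix_vector_symmetric[OF transpose_refl_mat] refl_w
        inner_matrix_vector_symmetric[OF sym] linear_neg[OF matrix_vector_mul_linear])
  have "\<mu> * (norm h)\<^sup>2 = (\<Sum>i<CARD('n). \<mu> * (h \<bullet> w i)\<^sup>2)"
    unfolding power2_norm_eq_inner orthonormal_basis_inner[OF w, of h h] sum_distrib_left
    by (simp add: power2_eq_square)
  also have "\<dots> \<le> (\<Sum>i<CARD('n). (if i < k then - l i else l i) * (h \<bullet> w i)\<^sup>2)"
  proof (intro sum_mono mult_right_mono)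
    fix i assume i: "i \<in> {..<CARD('n)}"
    show "\<mu> \<le> (if i < k then - l i else l i)"
    proof (cases "i < k")
      case True
      then show ?thesis using neg[OF True] l_neg[OF True] by simp
    next
      case False
      then obtain j where "j \<ge> k" "j < CARD('n)" "l i = eigvals A ! j"
        using l_pos[of i] i by auto
      then show ?thesis using pos[of j] False by simp
    qed
  qed simp
  also have "\<dots> = h \<bullet> (refl_mat k v *v (A *v h))"
    unfolding orthonormal_basis_inner[OF w, of h "refl_mat k v *v (A *v h)"]
    by (intro sum.cong) (simp_all add: coeff power2_eq_square)
  finally show ?thesis .
qed

text \<open>Replacing the exact by the computed reflection changes the quadratic form by at most 2
  \<delta> L |h|^2. The threshold \<mu> / (4 L) makes this half of the coercivity constant.\<close>

lemma reflected_hessian_coercive: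
  fixes A :: "real^'n^'n"
  assumes sym: "transpose A = A" and bound: "\<And>h. norm (A *v h) \<le> L * norm h" and "0 < L"
    and coercive: "\<And>h. \<mu> * (norm h)\<^sup>2 \<le> h \<bullet> (refl_mat k v *v (A *v h))"
    and close: "spectral_norm (proj_mat k w - proj_mat k v) \<le> \<mu> / (4 * L)"
  shows "\<mu> / 2 * (norm h)\<^sup>2 \<le> h \<bullet> (reflected_hessian k w A *v h)"
proof -
  let ?R = "refl_mat k v" and ?R' = "refl_mat k w"
  let ?\<delta> = "spectral_norm (proj_mat k w - proj_mat k v)"
  \<comment> \<open>A and the computed reflection are symmetric, so both orders of the product have
    the same quadratic form and the average can be replaced by one of them.\<close>
  have "h \<bullet> (A *v (?R' *v h)) = h \<bullet> (?R' *v (A *v h))"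
    by (metis inner_commute inner_matrix_vector_symmetric[OF sym]
        inner_matrix_vector_symmetric[OF transpose_refl_mat])
  then have "h \<bullet> (reflected_hessian k w A *v h) = h \<bullet> (?R' *v (A *v h))"
    by (simp add: reflected_hessian_mult inner_add_right)
  also have "\<dots> = h \<bullet> (?R *v (A *v h)) + h \<bullet> (?R' *v (A *v h) - ?R *v (A *v h))"
    by (simp add: inner_diff_right)
  also have "\<dots> \<ge> \<mu> * (norm h)\<^sup>2 - \<mu> / 2 * (norm h)\<^sup>2"
  proof -
    have "\<bar>h \<bullet> (?R' *v (A *v h) - ?R *v (A *v h))\<bar> \<le> norm h * (2 * ?\<delta> * norm (A *v h))"
      by (rule order_trans[OF Cauchy_Schwarz_ineq2 mult_left_mono[OF norm_refl_mat_diff_le]]) simp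
    also have "\<dots> \<le> norm h * (2 * (\<mu> / (4 * L)) * (L * norm h))"
      using close bound spectral_norm_nonneg[of "proj_mat k w - proj_mat k v"] \<open>0 < L\<close>
      by (intro mult_left_mono mult_mono) auto
    also have "\<dots> = \<mu> / 2 * (norm h)\<^sup>2"
      using \<open>0 < L\<close> by (simp add: power2_eq_square)
    finally show ?thesis using coercive[of h] by linarith
  qed
  finally show ?thesis by (simp add: algebra_simps)
qed

text \<open>The difference is half the commutator of A with the computed reflection. Subtracting the
  vanishing commutator with the exact one leaves two terms, each at most 2 \<delta> L |h|.\<close>

lemma reflected_hessian_commutator_le:
  fixes A :: "real^'n^'n"
  assumes bound: "\<And>h. norm (A *v h) \<le> L * norm h" and "0 \<le> L"
    and commute: "\<And>h. A *v (refl_mat k v *v h) = refl_mat k v *v (A *v h)"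
  shows "norm (reflected_hessian k w A *v h - refl_mat k w *v (A *v h))
    \<le> 2 * L * spectral_norm (proj_mat k w - proj_mat k v) * norm h"
proof -
  let ?R = "refl_mat k v" and ?R' = "refl_mat k w"
  let ?\<delta> = "spectral_norm (proj_mat k w - proj_mat k v)"
  have "reflected_hessian k w A *v h - ?R' *v (A *v h) = (1/2) *\<^sub>R (A *v (?R' *v h) - ?R' *v (A *v h))"
    by (simp add: reflected_hessian_mult vec_eq_iff)
  also have "A *v (?R' *v h) - ?R' *v (A *v h)
      = A *v (?R' *v h - ?R *v h) - (?R' *v (A *v h) - ?R *v (A *v h))"
    by (simp add: matrix_vector_mult_diff_distrib commute)
  finally have "norm (reflected_hessian k w A *v h - ?R' *v (A *v h))
      = 1/2 * norm (A *v (?R' *v h - ?R *v h) - (?R' *v (A *v h) - ?R *v (A *v h)))" by simp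
  also have "\<dots> \<le> 1/2 * (norm (A *v (?R' *v h - ?R *v h)) + norm (?R' *v (A *v h) - ?R *v (A *v h)))"
    by (intro mult_left_mono norm_triangle_ineq4) simp
  also have "norm (A *v (?R' *v h - ?R *v h)) \<le> L * (2 * ?\<delta> * norm h)"
    by (rule order_trans[OF bound mult_left_mono[OF norm_refl_mat_diff_le \<open>0 \<le> L\<close>]])
  also have "norm (?R' *v (A *v h) - ?R *v (A *v h)) \<le> 2 * ?\<delta> * (L * norm h)"
    by (rule order_trans[OF norm_refl_mat_diff_le mult_left_mono[OF bound]])
      (simp add: spectral_norm_nonneg)
  finally show ?thesis by (simp add: mult_ac)
qed

section \<open>The error recursion\<close>

text \<open>Along the segment the derivative of the gradient differs from its value at x by at most
  M |x - x'|. The mean value inequality contributes one more factor |x - x'|.\<close>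

lemma gradient_linearization_error_le:
  assumes f: "C_class 2 f" and crit: "gradient f x' = 0" and x: "x \<in> cball x' r"
    and lip: "\<And>y z. y \<in> cball x' r \<Longrightarrow> z \<in> cball x' r \<Longrightarrow>
      spectral_norm (hessian f y - hessian f z) \<le> M * norm (y - z)" and "0 \<le> M"
  shows "norm (hessian f x *v (x - x') - gradient f x) \<le> M * (norm (x - x'))\<^sup>2"
proof -
  let ?S = "closed_segment x x'"
  have "x' \<in> cball x' r" using order_trans[OF zero_le_dist x[unfolded mem_cball]] by simp
  with x have S: "?S \<subseteq> cball x' r"
    by (simp add: closed_segment_subset)
  have "norm (gradient f x' - gradient f x - hessian f x *v (x' - x)) \<le> norm (x' - x) * (M * norm (x - x'))"
  proof (rule differentiable_bound_linearization[where S = ?S and f' = "\<lambda>z. (*v) (hessian f z)" and ?x0.0 = x])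
    show "x + t *\<^sub>R (x' - x) \<in> ?S" if "t \<in> {0..1}" for t
    proof -
      have "x + t *\<^sub>R (x' - x) = (1 - t) *\<^sub>R x + t *\<^sub>R x'" by (simp add: algebra_simps)
      then show ?thesis using that unfolding in_segment by auto
    qed
    show "(gradient f has_derivative (*v) (hessian f z)) (at z within ?S)" for z
      using gradient_has_derivative_hessian[OF f] by (rule has_derivative_at_withinI)
    show "onorm ((*v) (hessian f z) - (*v) (hessian f x)) \<le> M * norm (x - x')" if "z \<in> ?S" for z
    proof -
      have "onorm ((*v) (hessian f z) - (*v) (hessian f x)) = spectral_norm (hessian f z - hessian f x)"
        unfolding spectral_norm_def by (rule arg_cong[of _ _ onorm]) (auto simp: fun_eq_iff matrix_vector_mult_diff_rdistrib)
      also have "\<dots> \<le> M * norm (z - x)"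
        using that S x by (intro lip) auto
      also have "\<dots> \<le> M * norm (x - x')"
        using segment_bound(1)[OF that] \<open>0 \<le> M\<close> by (simp add: mult_left_mono norm_minus_commute)
      finally show ?thesis .
    qed
  qed simp
  moreover have "gradient f x' - gradient f x - hessian f x *v (x' - x)
      = hessian f x *v (x - x') - gradient f x"
    by (simp add: crit matrix_vector_mult_diff_distrib)
  ultimately show ?thesis by (simp add: power2_eq_square norm_minus_commute mult_ac)
qed

lemma norm_gradient_le:
  assumes f: "C_class 2 f" and crit: "gradient f x' = 0" and x: "x \<in> cball x' r"
    and bound: "\<And>y h. y \<in> cball x' r \<Longrightarrow> norm (hessian f y *v h) \<le> L * norm h"
  shows "norm (gradient f x) \<le> L * norm (x - x')"
proof -
  have "x' \<in> cball x' r" using order_trans[OF zero_le_dist x[unfolded mem_cball]] by simp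
  with x have "norm (gradient f x - gradient f x') \<le> L * norm (x - x')"
    by (intro differentiable_bound[where S = "cball x' r" and f' = "\<lambda>y. (*v) (hessian f y)"]
        has_derivative_at_withinI[OF gradient_has_derivative_hessian[OF f]] onorm_le bound) auto
  then show ?thesis by (simp add: crit)
qed

section \<open>Estimates for a single cubic step\<close>

lemma norm_le_of_coercive:
  fixes z y :: "'a::real_inner"
  assumes "c * (norm z)\<^sup>2 \<le> z \<bullet> y"
  shows "c * norm z \<le> norm y"
proof (cases "z = 0")
  case False
  have "(c * norm z) * norm z \<le> norm y * norm z"
    using order_trans[OF assms norm_cauchy_schwarz] by (simp add: power2_eq_square mult_ac)
  then show ?thesis using False by simp
qed simp

lemma cubic_step_norm_le:
  fixes B :: "real^'n^'n"
  assumes "c * (norm s)\<^sup>2 \<le> s \<bullet> (B *v s)" and "0 \<le> \<sigma>"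
    and "\<xi> = p + B *v s + (\<sigma> * norm s) *\<^sub>R s"
  shows "c * norm s \<le> norm \<xi> + norm p"
proof -
  have "c * (norm s)\<^sup>2 \<le> s \<bullet> (\<xi> - p)"
    using assms(1,2) by (simp add: assms(3) inner_add_right add_increasing2)
  then have "c * norm s \<le> norm (\<xi> - p)" by (rule norm_le_of_coercive)
  then show ?thesis using norm_triangle_ineq4[of \<xi> p] by linarith
qed

text \<open>Here e + s plays the next error. The gradient g enters only through H e - g, which is of
  second order in e, and the isometry removes R from that term.\<close>

lemma cubic_step_error_le:
  fixes B H R :: "real^'n^'n"
  assumes coercive: "c * (norm (e + s))\<^sup>2 \<le> (e + s) \<bullet> (B *v (e + s))" and "0 \<le> \<sigma>"
    and \<xi>: "\<xi> = R *v g + B *v s + (\<sigma> * norm s) *\<^sub>R s"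
    and isometry: "norm (R *v (H *v e - g)) = norm (H *v e - g)"
  shows "c * norm (e + s) \<le> norm (B *v e - R *v (H *v e)) + norm (H *v e - g) + norm \<xi> + \<sigma> * (norm s)\<^sup>2"
proof -
  have "c * norm (e + s) \<le> norm (B *v (e + s))"
    by (rule norm_le_of_coercive[OF coercive])
  also have "B *v (e + s) = ((B *v e - R *v (H *v e)) + R *v (H *v e - g)) + (\<xi> - (\<sigma> * norm s) *\<^sub>R s)"
    by (simp add: \<xi> matrix_vector_right_distrib matrix_vector_mult_diff_distrib)
  also have "norm \<dots> \<le> (norm (B *v e - R *v (H *v e)) + norm (R *v (H *v e - g)))
      + (norm \<xi> + norm ((\<sigma> * norm s) *\<^sub>R s))"
    by (intro norm_triangle_mono norm_triangle_ineq norm_triangle_ineq4)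
  finally show ?thesis
    using \<open>0 \<le> \<sigma>\<close> by (simp add: isometry power2_eq_square)
qed

section \<open>Linear, superlinear and quadratic convergence of the iterates\<close>

theorem corollary3p2:
  fixes f :: "real^'n \<Rightarrow> real"
    and k :: nat
    and x' :: "real^'n"
    and r0 M L \<mu> \<sigma>min \<sigma>max \<eta>bar \<delta>bar \<epsilon> K \<rho> r C1 C2 rlin q :: real
    and \<sigma> \<eta> \<delta> :: "nat \<Rightarrow> real"
    and v V :: "nat \<Rightarrow> nat \<Rightarrow> real^'n"
    and \<xi> s x :: "nat \<Rightarrow> real^'n"
  assumes dim: "CARD('n) \<ge> 2"
    and C3: "C_class 3 f"
    and crit: "finite {y. gradient f y = 0 \<and> invertible (hessian f y)}"
    and k: "k \<le> CARD('n)"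
    and index: "strict_index_critical_point f k x'"
    and params: "r0 > 0" "M > 0" "\<mu> > 0" "\<mu> \<le> L"
    and lipschitz: "\<forall>y\<in>cball x' r0. \<forall>z\<in>cball x' r0.
          spectral_norm (hessian f y - hessian f z) \<le> M * norm (y - z)"
    and spec_neg: "\<forall>y\<in>cball x' r0. \<forall>i<k.
          - L \<le> eigvals (hessian f y) ! i \<and> eigvals (hessian f y) ! i \<le> - \<mu>"
    and spec_pos: "\<forall>y\<in>cball x' r0. \<forall>i. k \<le> i \<and> i < CARD('n) \<longrightarrow>
          \<mu> \<le> eigvals (hessian f y) ! i \<and> eigvals (hessian f y) ! i \<le> L"
    and sigma: "0 < \<sigma>min" "\<forall>j. \<sigma>min \<le> \<sigma> j \<and> \<sigma> j \<le> \<sigma>max"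
    and eta_nonneg: "\<forall>j. 0 \<le> \<eta> j"
    and iter: "inexact_index_cubic_iteration f k \<sigma> \<eta> v V \<delta> \<xi> s x"
    and bars: "0 \<le> \<eta>bar" "0 \<le> \<delta>bar" "\<delta>bar \<le> \<mu> / (4 * L)"
    and delta_le: "\<forall>j. \<delta> j \<le> \<delta>bar"
    and eta_le: "\<forall>j. \<eta> j \<le> \<eta>bar"
    and K_eq: "K = 2 * (1 + \<eta>bar) / \<mu>"
    and rho_eq: "\<rho> = min r0 (\<mu> / M)"
    and r_eq: "r = \<rho> / (1 + K * L)"
    and C1_eq: "C1 = 2 * L / \<mu> * max 1 (2 * L * K)"
    and C2_eq: "C2 = 2 / \<mu> * (\<sigma>max + M / 2) * K\<^sup>2 * L\<^sup>2"
    and eps: "\<forall>j. \<delta> j + \<eta> j \<le> \<epsilon>" "C1 * \<epsilon> < 1"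
    and rlin_eq: "rlin = min r ((1 - C1 * \<epsilon>) / (2 * C2))"
    and q_eq: "q = C1 * \<epsilon> + C2 * rlin"
    and start: "norm (x 0 - x') \<le> rlin"
  shows
    "((\<forall>j. norm (x (Suc j) - x') \<le> q * norm (x j - x')) \<and>
      q \<le> (1 + C1 * \<epsilon>) / 2 \<and> (1 + C1 * \<epsilon>) / 2 < 1 \<and> converges_linearly x x') \<and>
     ((\<lambda>j. \<delta> j + \<eta> j) \<longlonglongrightarrow> 0 \<longrightarrow> converges_superlinearly x x') \<and>
     ((\<lambda>j. \<delta> j + \<eta> j) \<longlonglongrightarrow> 0 \<and>
        (\<exists>c>0. \<forall>\<^sub>F j in sequentially. \<delta> j + \<eta> j \<le> c * norm (x j - x')) \<longrightarrow>
      converges_quadratically x x') \<and>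
     (\<delta> \<in> O(\<lambda>j. norm (gradient f (x j))) \<and>
        ((\<lambda>j. norm (\<xi> j)) \<in> O(\<lambda>j. (norm (gradient f (x j)))\<^sup>2) \<or>
         \<eta> \<in> O(\<lambda>j. norm (gradient f (x j)))) \<longrightarrow>
      converges_quadratically x x')"
proof -
  have f2: "C_class 2 f"
    using C3 by (auto simp: numeral_3_eq_3 numeral_2_eq_2 intro: differentiable_imp_continuous_on)
  define e where "e j = norm (x j - x')" for j
  have e_nonneg: "0 \<le> e j" for j by (simp add: e_def)
  have "0 < L" "0 \<le> M" "0 < K" "0 < \<sigma>max"
    using params bars(1) sigma by (auto simp: K_eq intro: order_less_le_trans)
  \<comment> \<open>From \<mu> <= L follows K L >= 2, the slack that lets the prescribed C1 and C2
    dominate the constants derived below.\<close>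
  have "2 * \<mu> \<le> 2 * (1 + \<eta>bar) * L"
    using params bars(1) by (intro mult_mono) auto
  then have KL: "2 \<le> K * L"
    using \<open>0 < \<mu>\<close> by (simp add: K_eq pos_le_divide_eq)
  have KL_sq: "4 \<le> K\<^sup>2 * L\<^sup>2"
    using power_mono[OF KL, of 2] by (simp add: power_mult_distrib)

  have sym: "transpose (hessian f y) = hessian f y" for y
    by (rule transpose_hessian[OF f2])
  have hess_bound: "norm (hessian f y *v h) \<le> L * norm h" if y: "y \<in> cball x' r0" for y h
  proof (rule norm_symmetric_matrix_vector_le[OF sym])
    fix i assume "i < CARD('n)"
    then show "\<bar>eigvals (hessian f y) ! i\<bar> \<le> L"
      using spec_neg[rule_format, OF y, of i] spec_pos[rule_format, OF y, of i] params
      by (cases "i < k") auto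
  qed
  have v: "lowest_eigenvectors k (hessian f (x j)) (v j)"
    and V: "orthonormal_family k (V j)"
    and \<delta>: "\<delta> j = spectral_norm (proj_mat k (V j) - proj_mat k (v j))"
    and \<xi>: "\<xi> j = refl_mat k (V j) *v gradient f (x j)
                + reflected_hessian k (V j) (hessian f (x j)) *v s j + (\<sigma> j * norm (s j)) *\<^sub>R s j"
    and \<xi>_le: "norm (\<xi> j) \<le> \<eta> j * norm (gradient f (x j))"
    and x_Suc: "x (Suc j) = x j + s j" for j
    using iter unfolding inexact_index_cubic_iteration_def by blast+
  have \<delta>_nonneg: "0 \<le> \<delta> j" for j by (simp add: \<delta> spectral_norm_nonneg)
  have grad_le: "norm (gradient f (x j)) \<le> L * e j" if "x j \<in> cball x' r0" for j
    unfolding e_def using index that hess_bound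
    by (intro norm_gradient_le[OF f2]) (auto simp: strict_index_critical_point_def)

  \<comment> \<open>D collects the coefficients of the squared error: M from linearization, the rest
    from the cubic term with |s_j| <= K L e_j.\<close>
  define D where "D = M + \<sigma>max * (K\<^sup>2 * L\<^sup>2)"
  \<comment> \<open>The residual norm is kept as it is, not replaced by its bound through \<eta>,
    because one alternative in (iv) controls only the residual.\<close>
  have step: "\<mu> / 2 * e (Suc j) \<le> 2 * L * \<delta> j * e j + norm (\<xi> j) + D * (e j)\<^sup>2"
    if xj: "x j \<in> cball x' r0" for j
  proof -
    let ?H = "hessian f (x j)" and ?g = "gradient f (x j)"
    let ?R = "refl_mat k (V j)" and ?B = "reflected_hessian k (V j) (hessian f (x j))"
    have \<sigma>j: "0 \<le> \<sigma> j" "\<sigma> j \<le> \<sigma>max" using sigma by (auto intro: order_trans less_imp_le)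
    have "\<mu> * (norm h)\<^sup>2 \<le> h \<bullet> (refl_mat k (v j) *v (?H *v h))" for h
      using spec_neg spec_pos xj by (intro refl_mat_lowest_eigenvectors_coercive[OF sym k v]) auto
    then have coercive: "\<mu> / 2 * (norm h)\<^sup>2 \<le> h \<bullet> (?B *v h)" for h
      using order_trans[OF delta_le[rule_format] bars(3)]
      by (intro reflected_hessian_coercive[OF sym hess_bound[OF xj] \<open>0 < L\<close>]) (auto simp: \<delta>)
    have "\<mu> / 2 * norm (s j) \<le> norm (\<xi> j) + norm (?R *v ?g)"
      by (rule cubic_step_norm_le[OF coercive \<sigma>j(1) \<xi>])
    also have "\<dots> \<le> \<eta>bar * norm ?g + norm ?g"
      unfolding norm_refl_mat_mult[OF V]
      using eta_le by (intro add_right_mono order_trans[OF \<xi>_le] mult_right_mono) auto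
    \<comment> \<open>Dividing by \<mu> / 2 produces exactly the constant K.\<close>
    finally have "norm (s j) \<le> K * norm ?g"
      using \<open>0 < \<mu>\<close> by (simp add: K_eq field_simps)
    also have "\<dots> \<le> K * (L * e j)"
      using \<open>0 < K\<close> grad_le[OF xj] by (intro mult_left_mono) auto
    finally have s_le: "(norm (s j))\<^sup>2 \<le> K\<^sup>2 * L\<^sup>2 * (e j)\<^sup>2"
      using power_mono[of "norm (s j)" "K * (L * e j)" 2] by (simp add: power_mult_distrib mult_ac)
    have "x (Suc j) - x' = (x j - x') + s j" by (simp add: x_Suc)
    then have "\<mu> / 2 * e (Suc j) \<le> norm (?B *v (x j - x') - ?R *v (?H *v (x j - x')))
        + norm (?H *v (x j - x') - ?g) + norm (\<xi> j) + \<sigma> j * (norm (s j))\<^sup>2"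
      unfolding e_def
      by (simp only:) (rule cubic_step_error_le[OF coercive \<sigma>j(1) \<xi> norm_refl_mat_mult[OF V]])
    also have "norm (?B *v (x j - x') - ?R *v (?H *v (x j - x'))) \<le> 2 * L * \<delta> j * e j"
      unfolding \<delta> e_def using \<open>0 < L\<close>
      by (intro reflected_hessian_commutator_le hess_bound[OF xj]
          refl_mat_lowest_eigenvectors_commute[OF sym v]) auto
    also have "norm (?H *v (x j - x') - ?g) \<le> M * (e j)\<^sup>2"
      unfolding e_def using index lipschitz \<open>0 \<le> M\<close>
      by (intro gradient_linearization_error_le[OF f2 _ xj]) (auto simp: strict_index_critical_point_def)
    also have "\<sigma> j * (norm (s j))\<^sup>2 \<le> \<sigma>max * (K\<^sup>2 * L\<^sup>2 * (e j)\<^sup>2)"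
      using \<sigma>j s_le by (intro mult_mono) auto
    finally show ?thesis by (simp add: D_def algebra_simps)
  qed

  \<comment> \<open>Dividing \<open>step\<close> by \<mu> / 2 turns its factor 2 L into 4 L / \<mu>.
    The maximum in C1 covers this because 2 L K >= 4.\<close>
  have "2 * L / \<mu> * 2 \<le> 2 * L / \<mu> * max 1 (2 * L * K)"
    using KL \<open>0 < L\<close> \<open>0 < \<mu>\<close> by (intro mult_left_mono) (auto simp: mult_ac)
  then have C1: "4 * L / \<mu> \<le> C1" by (simp add: C1_eq)
  then have "0 \<le> C1" using \<open>0 < L\<close> \<open>0 < \<mu>\<close> by (meson divide_nonneg_pos mult_nonneg_nonneg less_imp_le order_trans zero_le_numeral)
  \<comment> \<open>The linearization bound has the constant M instead of the sharp M / 2; K L >= 2 absorbs the loss.\<close>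
  have "M \<le> M / 2 * (K\<^sup>2 * L\<^sup>2)"
    using mult_left_mono[OF KL_sq, of "M / 2"] \<open>0 \<le> M\<close> by linarith
  then have "D \<le> (\<sigma>max + M / 2) * (K\<^sup>2 * L\<^sup>2)" by (simp add: D_def distrib_right)
  then have C2: "2 / \<mu> * D \<le> C2"
    unfolding C2_eq mult.assoc using \<open>0 < \<mu>\<close> by (intro mult_left_mono) auto
  have "0 < C2"
    using \<open>0 < \<mu>\<close> \<open>0 < K\<close> \<open>0 < L\<close> \<open>0 < \<sigma>max\<close> \<open>0 \<le> M\<close> by (simp add: C2_eq)
  have contraction: "e (Suc j) \<le> (C1 * (\<delta> j + \<eta> j) + C2 * e j) * e j" if xj: "x j \<in> cball x' r0" for j
  proof -
    have "norm (\<xi> j) \<le> \<eta> j * (L * e j)"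
      using eta_nonneg by (intro order_trans[OF \<xi>_le] mult_left_mono grad_le[OF xj]) auto
    \<comment> \<open>The bound is doubled so that \<delta> and \<eta> share the factor 2 L.\<close>
    also have "\<dots> \<le> 2 * L * \<eta> j * e j"
      using eta_nonneg e_nonneg[of j] \<open>0 < L\<close> by simp
    finally have "\<mu> / 2 * e (Suc j) \<le> 2 * L * (\<delta> j + \<eta> j) * e j + D * (e j)\<^sup>2"
      using step[OF xj] by (simp add: algebra_simps)
    then have "e (Suc j) \<le> 4 * L / \<mu> * ((\<delta> j + \<eta> j) * e j) + 2 / \<mu> * D * (e j)\<^sup>2"
      using \<open>0 < \<mu>\<close> by (simp add: field_simps)
    also have "\<dots> \<le> C1 * ((\<delta> j + \<eta> j) * e j) + C2 * (e j)\<^sup>2"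
      using C1 C2 \<delta>_nonneg eta_nonneg e_nonneg by (intro add_mono mult_right_mono) auto
    finally show ?thesis by (simp add: power2_eq_square algebra_simps)
  qed

  have "0 < r" "r \<le> r0"
  proof -
    have "0 < \<rho>" "\<rho> \<le> r0" using params by (auto simp: rho_eq)
    moreover have "1 \<le> 1 + K * L" using KL by simp
    ultimately show "0 < r" "r \<le> r0"
      using divide_left_mono[of 1 "1 + K * L" \<rho>] by (auto simp: r_eq)
  qed
  have "0 < rlin" "rlin \<le> r0"
    using \<open>0 < r\<close> \<open>r \<le> r0\<close> eps(2) \<open>0 < C2\<close> by (auto simp: rlin_eq)
  have "0 \<le> \<epsilon>"
    using eps(1) \<delta>_nonneg eta_nonneg by (meson add_nonneg_nonneg order_trans)
  have "0 \<le> q"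
    using \<open>0 \<le> C1\<close> \<open>0 \<le> \<epsilon>\<close> \<open>0 < C2\<close> \<open>0 < rlin\<close> by (simp add: q_eq)
  have "C2 * rlin \<le> C2 * ((1 - C1 * \<epsilon>) / (2 * C2))"
    using \<open>0 < C2\<close> by (intro mult_left_mono) (auto simp: rlin_eq)
  also have "\<dots> = (1 - C1 * \<epsilon>) / 2" using \<open>0 < C2\<close> by simp
  finally have q_le: "q \<le> (1 + C1 * \<epsilon>) / 2" by (simp add: q_eq)
  have half_lt_1: "(1 + C1 * \<epsilon>) / 2 < 1" using eps(2) by simp
  with q_le have "q < 1" by simp

  \<comment> \<open>The two claims go together: the contraction estimate is available only inside
    the ball where the spectral and Lipschitz bounds hold.\<close>
  have e_le_imp: "x j \<in> cball x' r0 \<and> e (Suc j) \<le> q * e j" if "e j \<le> rlin" for j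
  proof
    show xj: "x j \<in> cball x' r0"
      using that \<open>rlin \<le> r0\<close> by (simp add: e_def dist_norm norm_minus_commute)
    have "C1 * (\<delta> j + \<eta> j) + C2 * e j \<le> q"
      unfolding q_eq using eps(1) that \<open>0 \<le> C1\<close> \<open>0 < C2\<close> by (intro add_mono mult_left_mono) auto
    then show "e (Suc j) \<le> q * e j"
      using e_nonneg by (intro order_trans[OF contraction[OF xj]] mult_right_mono) auto
  qed
  \<comment> \<open>Since q < 1, the errors never grow, so the iterates never leave the starting
    neighbourhood and the local estimates hold for every j.\<close>
  have e_le: "e j \<le> rlin" for j
  proof (induction j)
    case 0
    then show ?case using start by (simp add: e_def)
  next
    case (Suc j)
    then have "e (Suc j) \<le> q * e j" using e_le_imp by blast
    also have "\<dots> \<le> e j" using \<open>q < 1\<close> e_nonneg[of j] \<open>0 \<le> q\<close> by (simp add: mult_left_le_one_le)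
    finally show ?case using Suc.IH by simp
  qed
  have ball: "x j \<in> cball x' r0" and linear: "e (Suc j) \<le> q * e j" for j
    using e_le_imp[OF e_le] by auto
  have e_le_pow: "e j \<le> q ^ j * e 0" for j
  proof (induction j)
    case (Suc j)
    then show ?case using linear[of j] mult_left_mono[OF Suc.IH \<open>0 \<le> q\<close>] by (simp add: mult_ac)
  qed simp
  have pow_lim: "(\<lambda>j. q ^ j * e 0) \<longlonglongrightarrow> 0"
    using \<open>0 \<le> q\<close> \<open>q < 1\<close> by (intro tendsto_mult_left_zero LIMSEQ_power_zero) simp
  have e_lim: "e \<longlonglongrightarrow> 0"
    by (rule tendsto_sandwich[OF always_eventually always_eventually tendsto_const pow_lim])
      (use e_nonneg e_le_pow in blast)+
  then have x_lim: "x \<longlonglongrightarrow> x'"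
    unfolding e_def[abs_def] by (rule LIM_zero_cancel[OF tendsto_norm_zero_cancel])

  \<comment> \<open>Common criterion for (iii) and (iv): the only terms of \<open>step\<close> that
    are not already quadratic come from the subspace error and the residual.\<close>
  have quadratic: "converges_quadratically x x'"
    if c: "\<forall>\<^sub>F j in sequentially. 2 * L * \<delta> j * e j + norm (\<xi> j) \<le> c * (e j)\<^sup>2" for c
  proof -
    have "\<forall>\<^sub>F j in sequentially. e (Suc j) \<le> 2 / \<mu> * (c + D) * (e j)\<^sup>2"
      using c
    proof eventually_elim
      case (elim j)
      then have "\<mu> / 2 * e (Suc j) \<le> (c + D) * (e j)\<^sup>2"
        using step[OF ball, of j] by (simp add: distrib_right)
      then show ?case using \<open>0 < \<mu>\<close> by (simp add: field_simps)
    qed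
    then show ?thesis using x_lim unfolding converges_quadratically_def e_def by blast
  qed
  have \<xi>_le_e: "norm (\<xi> j) \<le> \<eta> j * (L * e j)" for j
    using eta_nonneg by (intro order_trans[OF \<xi>_le] mult_left_mono grad_le[OF ball]) auto

  have i: "converges_linearly x x'"
    unfolding converges_linearly_def using x_lim linear \<open>0 \<le> q\<close> \<open>q < 1\<close> by (auto simp: e_def)
  have ii: "converges_superlinearly x x'" if "(\<lambda>j. \<delta> j + \<eta> j) \<longlonglongrightarrow> 0"
  proof -
    \<comment> \<open>The contraction factor itself serves as the null sequence \<theta>.\<close>
    have "(\<lambda>j. C1 * (\<delta> j + \<eta> j) + C2 * e j) \<longlonglongrightarrow> 0"
      using tendsto_add[OF tendsto_mult_right_zero[OF that, of C1] tendsto_mult_right_zero[OF e_lim, of C2]]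
      by simp
    then show ?thesis
      unfolding converges_superlinearly_def using x_lim contraction[OF ball, unfolded e_def]
      by (auto simp: e_def)
  qed
  have iii: "converges_quadratically x x'"
    if "\<forall>\<^sub>F j in sequentially. \<delta> j + \<eta> j \<le> c * norm (x j - x')" for c
  proof (rule quadratic)
    show "\<forall>\<^sub>F j in sequentially. 2 * L * \<delta> j * e j + norm (\<xi> j) \<le> 2 * L * c * (e j)\<^sup>2"
      using that
    proof eventually_elim
      case (elim j)
      have "\<eta> j * (L * e j) \<le> 2 * L * \<eta> j * e j"
        using eta_nonneg e_nonneg[of j] \<open>0 < L\<close> by simp
      then have "2 * L * \<delta> j * e j + norm (\<xi> j) \<le> (\<delta> j + \<eta> j) * (2 * L * e j)"
        using \<xi>_le_e[of j] by (simp add: algebra_simps)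
      also have "\<dots> \<le> (c * e j) * (2 * L * e j)"
        using elim \<open>0 < L\<close> e_nonneg by (intro mult_right_mono) (auto simp: e_def)
      finally show ?case by (simp add: power2_eq_square mult_ac)
    qed
  qed
  have iv: "converges_quadratically x x'"
    if \<delta>_O: "\<delta> \<in> O(\<lambda>j. norm (gradient f (x j)))"
      and \<xi>_O: "(\<lambda>j. norm (\<xi> j)) \<in> O(\<lambda>j. (norm (gradient f (x j)))\<^sup>2)
        \<or> \<eta> \<in> O(\<lambda>j. norm (gradient f (x j)))"
  proof -
    \<comment> \<open>Since the gradient is O(e), each hypothesis can be restated in terms of e. A
      factor O(e) in \<delta> or \<eta> then gains a second e from the term in which it
      occurs.\<close>
    have grad_O: "(\<lambda>j. norm (gradient f (x j))) \<in> O(e)"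
      using grad_le[OF ball] e_nonneg by (intro bigoI[of _ L]) auto
    have \<xi>_O_e: "(\<lambda>j. norm (\<xi> j)) \<in> O(\<lambda>j. (e j)\<^sup>2)"
      using \<xi>_O
    proof
      assume "(\<lambda>j. norm (\<xi> j)) \<in> O(\<lambda>j. (norm (gradient f (x j)))\<^sup>2)"
      also have "(\<lambda>j. (norm (gradient f (x j)))\<^sup>2) \<in> O(\<lambda>j. (e j)\<^sup>2)"
        by (intro landau_o.big_power grad_O)
      finally show ?thesis .
    next
      assume "\<eta> \<in> O(\<lambda>j. norm (gradient f (x j)))"
      with grad_O have "\<eta> \<in> O(e)" by (rule landau_o.big_trans[rotated])
      then have "(\<lambda>j. \<eta> j * e j) \<in> O(\<lambda>j. (e j)\<^sup>2)"
        unfolding power2_eq_square by (rule landau_o.big_mult) simp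
      moreover have "(\<lambda>j. norm (\<xi> j)) \<in> O(\<lambda>j. \<eta> j * e j)"
        using \<xi>_le_e eta_nonneg e_nonneg by (intro bigoI[of _ L]) (auto simp: mult_ac)
      ultimately show ?thesis by (rule landau_o.big_trans[rotated])
    qed
    have "\<delta> \<in> O(e)" using grad_O \<delta>_O by (rule landau_o.big_trans[rotated])
    then have "(\<lambda>j. \<delta> j * e j) \<in> O(\<lambda>j. (e j)\<^sup>2)"
      unfolding power2_eq_square by (rule landau_o.big_mult) simp
    then have "(\<lambda>j. 2 * L * (\<delta> j * e j)) \<in> O(\<lambda>j. (e j)\<^sup>2)" by simp
    from sum_in_bigo(1)[OF this \<xi>_O_e] obtain c where
      "\<forall>\<^sub>F j in sequentially. norm (2 * L * (\<delta> j * e j) + norm (\<xi> j)) \<le> c * norm ((e j)\<^sup>2)"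
      by (auto elim: landau_o.bigE)
    then show ?thesis
      by (intro quadratic[of c]) (auto elim!: eventually_mono simp: mult_ac)
  qed
  show ?thesis
    by (intro conjI impI allI linear[unfolded e_def] q_le half_lt_1 i ii) (blast intro: iii iv)+
qed

end
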